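(* Let $G$ be a locally compact Hausdorff group. For a left (respectively right) Haar measure $\mu$ on $G$ let $\Phi\mu : C_c(G)\to\mathbb{C}$ be given by integration, $\Phi\mu(f)=\int_G f(g)\,d\mu(g)$. For a left (respectively right) Haar functional $\lambda$ on $G$ let $\Psi\lambda$ be the unique Radon measure on $G$, provided by the Riesz representation theorem, such that $\lambda(f)=\int_G f(g)\,d(\Psi\lambda)(g)$ for all $f\in C_c(G)$. Then $\Phi$ is a map from the set of left (respectively right) Haar measures on $G$ to the set of left (respectively right) Haar functionals on $G$, $\Psi$ is a map from the set of left (respectively right) Haar functionals on $G$ to the set of left (respectively right) Haar measures on $G$, and $\Phi$ and $\Psi$ are mutually inverse.
   Context: $C_c(X)$ denotes the space of continuous complex-valued functions with compact support on a topological space $X$. $\mathcal{B}(X)$ is the Borel $\sigma$-algebra of $X$. A Radon measure on $X$ is a measure $\mu$ on $(X,\mathcal{B}(X))$ such that (locally finite) $\mu(K)<\infty$ for every compact $K\subseteq X$; (outer regular) $\mu(E)=\inf\{\mu(U)\mid U\supseteq E,\ U\text{ open}\}$ for every measurable $E\subseteq X$; (inner regular) $\mu(U)=\sup\{\mu(K)\mid K\subseteq U,\ K\text{ compact}\}$ for every open $U\subseteq X$. A left (right) Haar measure on a locally compact Hausdorff group $G$ is a Radon measure $\mu$ on $(G,\mathcal{B}(G))$ with $\mu(U)>0$ for every non-empty open $U\subseteq G$ and $\mu(gE)=\mu(E)$ (respectively $\mu(Eg)=\mu(E)$) for all $E\in\mathcal{B}(G)$ and $g\in G$. A linear functional $\lambda:C_c(G)\to\mathbb{C}$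 is positive if $\lambda(f)\in[0,\infty)$ whenever $f(x)\in[0,\infty)$ for all $x\in G$. The left-regular and right-regular representations of $G$ on $C_c(G)$ are $(\lambda_G(g)f)(x)=f(g^{-1}x)$ and $(\varrho_G(g)f)(x)=f(xg)$. A left (right) Haar functional on $G$ is a non-zero positive linear functional on $C_c(G)$ which is invariant under $\lambda_G$ (respectively $\varrho_G$), i.e. $\lambda(\lambda_G(g)f)=\lambda(f)$ (respectively $\lambda(\varrho_G(g)f)=\lambda(f)$) for all $g\in G$, $f\in C_c(G)$. *)

theory Defs
  imports "HOL-Analysis.Analysis"
begin

text \<open>
  A topological group is a type of class \<^class>\<open>topological_group_add\<close>. This class does not
  assume commutativity: the group law $gh$ is written \<open>g + h\<close> and the inverse of $g$ is \<open>- g\<close>.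
\<close>

definition Cc :: "('a::topological_space \<Rightarrow> complex) set" where
  "Cc = {f. continuous_on UNIV f \<and> compact (closure {x. f x \<noteq> 0})}"

definition radon_measure :: "'a::topological_space measure \<Rightarrow> bool" where
  "radon_measure \<mu> \<longleftrightarrow>
     sets \<mu> = sets borel \<and>
     (\<forall>K. compact K \<longrightarrow> emeasure \<mu> K < \<infinity>) \<and>
     (\<forall>E\<in>sets borel. emeasure \<mu> E = (INF U\<in>{U. open U \<and> E \<subseteq> U}. emeasure \<mu> U)) \<and>
     (\<forall>U. open U \<longrightarrow> emeasure \<mu> U = (SUP K\<in>{K. compact K \<and> K \<subseteq> U}. emeasure \<mu> K))"

definition left_haar_measures :: "'a::topological_group_add measure set" where
  "left_haar_measures =
     {\<mu>. radon_measure \<mu> \<and>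
         (\<forall>U. open U \<and> U \<noteq> {} \<longrightarrow> emeasure \<mu> U > 0) \<and>
         (\<forall>E\<in>sets borel. \<forall>g. emeasure \<mu> ((\<lambda>x. g + x) ` E) = emeasure \<mu> E)}"

definition right_haar_measures :: "'a::topological_group_add measure set" where
  "right_haar_measures =
     {\<mu>. radon_measure \<mu> \<and>
         (\<forall>U. open U \<and> U \<noteq> {} \<longrightarrow> emeasure \<mu> U > 0) \<and>
         (\<forall>E\<in>sets borel. \<forall>g. emeasure \<mu> ((\<lambda>x. x + g) ` E) = emeasure \<mu> E)}"

definition left_regular :: "'a::group_add \<Rightarrow> ('a \<Rightarrow> complex) \<Rightarrow> 'a \<Rightarrow> complex" where
  "left_regular g f = (\<lambda>x. f (- g + x))"

definition right_regular :: "'a::group_add \<Rightarrow> ('a \<Rightarrow> complex) \<Rightarrow> 'a \<Rightarrow> complex" where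
  "right_regular g f = (\<lambda>x. f (x + g))"

text \<open>
  A functional is a function with domain \<^const>\<open>Cc\<close>, so it is required to be
  \<^const>\<open>extensional\<close> on \<^const>\<open>Cc\<close>; equality of two functionals then means equality of
  their values on \<^const>\<open>Cc\<close>.
\<close>

definition linear_functional :: "(('a::topological_space \<Rightarrow> complex) \<Rightarrow> complex) \<Rightarrow> bool" where
  "linear_functional L \<longleftrightarrow>
     L \<in> extensional Cc \<and>
     (\<forall>f\<in>Cc. \<forall>h\<in>Cc. L (\<lambda>x. f x + h x) = L f + L h) \<and>
     (\<forall>c. \<forall>f\<in>Cc. L (\<lambda>x. c * f x) = c * L f)"

definition positive_functional :: "(('a::topological_space \<Rightarrow> complex) \<Rightarrow> complex) \<Rightarrow> bool" where
  "positive_functional L \<longleftrightarrow>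
     (\<forall>f\<in>Cc. (\<forall>x. f x \<in> \<real>\<^sub>\<ge>\<^sub>0) \<longrightarrow> L f \<in> \<real>\<^sub>\<ge>\<^sub>0)"

definition left_haar_functionals ::
    "(('a::topological_group_add \<Rightarrow> complex) \<Rightarrow> complex) set" where
  "left_haar_functionals =
     {L. linear_functional L \<and> positive_functional L \<and> (\<exists>f\<in>Cc. L f \<noteq> 0) \<and>
         (\<forall>g. \<forall>f\<in>Cc. L (left_regular g f) = L f)}"

definition right_haar_functionals ::
    "(('a::topological_group_add \<Rightarrow> complex) \<Rightarrow> complex) set" where
  "right_haar_functionals =
     {L. linear_functional L \<and> positive_functional L \<and> (\<exists>f\<in>Cc. L f \<noteq> 0) \<and>
         (\<forall>g. \<forall>f\<in>Cc. L (right_regular g f) = L f)}"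

definition \<Phi> :: "'a::topological_space measure \<Rightarrow> ('a \<Rightarrow> complex) \<Rightarrow> complex" where
  "\<Phi> \<mu> = (\<lambda>f\<in>Cc. integral\<^sup>L \<mu> f)"

definition represents ::
    "'a::topological_space measure \<Rightarrow> (('a \<Rightarrow> complex) \<Rightarrow> complex) \<Rightarrow> bool" where
  "represents \<mu> L \<longleftrightarrow> radon_measure \<mu> \<and> (\<forall>f\<in>Cc. L f = integral\<^sup>L \<mu> f)"

definition \<Psi> :: "(('a::topological_space \<Rightarrow> complex) \<Rightarrow> complex) \<Rightarrow> 'a measure" where
  "\<Psi> L = (THE \<mu>. represents \<mu> L)"

end

theory Submission
  imports Defs
begin

text \<open>
  The heart of the matter is the Riesz representation theorem: on a locally compact Hausdorff space
  every positive linear functional on functions of compact support is integration against exactly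
  one Radon measure. Once this is known, invariance is formal. The image of a Radon measure under a
  translation is a Radon measure, and by change of variables it represents the translated
  functional; so, by uniqueness, the measure is invariant if and only if the functional is. The
  non-triviality conditions correspond too. A measure positive on open sets gives a positive
  integral to a Urysohn function, and a non-zero invariant functional cannot have a null non-empty
  open set, since finitely many translates of that set cover any compact set.

  Existence in the Riesz theorem follows the classical construction for the real functional \<open>I\<close>
  underlying the complex one. The content of an open \<open>U\<close> is the supremum of \<open>I f\<close> over functions
  \<open>f\<close> with values in $[0,1]$ and support in \<open>U\<close>, and the outer measure of a set is the infimum of
  the contents of its open neighbourhoods. Open sets satisfy Caratheodory's criterion
  (\<open>open_in_lambda_system\<close>), so this is a measure on the Borel sets, and it is a Radon measure
  (\<open>radon_measure_riesz_measure\<close>). That it represents \<open>I\<close> is the comparison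
  \<open>positive_real_functional_le\<close>: if the indicator of a compact set fits between \<open>f\<close> and \<open>g\<close>, then the
  measure of that set separates \<open>I f\<close> from the integral of \<open>g\<close>, and the integral of \<open>f\<close> from \<open>I g\<close>;
  cutting a function into thin horizontal slices turns these inequalities into equality.

  Uniqueness (\<open>represents_unique\<close>) holds because Urysohn functions recover the measure of open sets
  from integrals, and outer regularity recovers all Borel sets from the open ones.
\<close>

section \<open>Continuous functions of compact support\<close>

definition Cc_real :: "('a::topological_space \<Rightarrow> real) set" where
  "Cc_real = {f. continuous_on UNIV f \<and> compact (closure {x. f x \<noteq> 0})}"

lemma compact_closure_nonzero:
  fixes f :: "'a::t2_space \<Rightarrow> 'b::zero"
  assumes "compact K" "\<And>x. x \<notin> K \<Longrightarrow> f x = 0"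
  shows "compact (closure {x. f x \<noteq> 0})"
proof -
  have "closure {x. f x \<noteq> 0} \<subseteq> K"
    using assms by (intro closure_minimal compact_imp_closed) auto
  then show ?thesis
    using assms(1) by (metis closed_closure compact_Int_closed inf.absorb_iff2)
qed

lemma Cc_realI:
  fixes f :: "'a::t2_space \<Rightarrow> real"
  assumes "continuous_on UNIV f" "compact K" "\<And>x. x \<notin> K \<Longrightarrow> f x = 0"
  shows "f \<in> Cc_real"
  using assms(1) compact_closure_nonzero[of K f, OF assms(2,3)] by (simp add: Cc_real_def)

lemma CcI:
  fixes f :: "'a::t2_space \<Rightarrow> complex"
  assumes "continuous_on UNIV f" "compact K" "\<And>x. x \<notin> K \<Longrightarrow> f x = 0"
  shows "f \<in> Cc"
  using assms(1) compact_closure_nonzero[of K f, OF assms(2,3)] by (simp add: Cc_def)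

lemma Cc_realE:
  assumes "f \<in> Cc_real"
  obtains K where "continuous_on UNIV f" "compact K" "\<And>x. x \<notin> K \<Longrightarrow> f x = 0"
  using assms closure_subset[of "{x. f x \<noteq> 0}"] that unfolding Cc_real_def by blast

lemma CcE:
  assumes "f \<in> Cc"
  obtains K where "continuous_on UNIV f" "compact K" "\<And>x. x \<notin> K \<Longrightarrow> f x = 0"
  using assms closure_subset[of "{x. f x \<noteq> 0}"] that unfolding Cc_def by blast

lemma Cc_real_add:
  fixes f g :: "'a::t2_space \<Rightarrow> real"
  assumes "f \<in> Cc_real" "g \<in> Cc_real"
  shows "(\<lambda>x. f x + g x) \<in> Cc_real"
proof -
  obtain K where K: "continuous_on UNIV f" "compact K" "\<And>x. x \<notin> K \<Longrightarrow> f x = 0"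
    using assms(1) by (metis Cc_realE)
  obtain L where L: "continuous_on UNIV g" "compact L" "\<And>x. x \<notin> L \<Longrightarrow> g x = 0"
    using assms(2) by (metis Cc_realE)
  show ?thesis
    using K L by (intro Cc_realI[of _ "K \<union> L"] continuous_intros) auto
qed

lemma Cc_real_compose:
  fixes f :: "'a::t2_space \<Rightarrow> real"
  assumes "f \<in> Cc_real" "continuous_on UNIV h" "h 0 = 0"
  shows "(\<lambda>x. h (f x)) \<in> Cc_real"
proof -
  obtain K where K: "continuous_on UNIV f" "compact K" "\<And>x. x \<notin> K \<Longrightarrow> f x = 0"
    using assms(1) by (metis Cc_realE)
  have "continuous_on UNIV (\<lambda>x. h (f x))"
    using K(1) assms(2) by (metis continuous_on_compose2 subset_UNIV)
  then show ?thesis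
    using K assms(3) by (intro Cc_realI[of _ K]) auto
qed

lemma Cc_real_positive_part:
  fixes f :: "'a::t2_space \<Rightarrow> real"
  shows "f \<in> Cc_real \<Longrightarrow> (\<lambda>x. max 0 (f x)) \<in> Cc_real"
  by (rule Cc_real_compose[where h = "\<lambda>y. max 0 y"]) (auto intro!: continuous_intros)

lemma Cc_real_negative_part:
  fixes f :: "'a::t2_space \<Rightarrow> real"
  shows "f \<in> Cc_real \<Longrightarrow> (\<lambda>x. max 0 (- f x)) \<in> Cc_real"
  by (rule Cc_real_compose[where h = "\<lambda>y. max 0 (- y)"]) (auto intro!: continuous_intros)

lemma Cc_real_cmult:
  fixes f :: "'a::t2_space \<Rightarrow> real"
  shows "f \<in> Cc_real \<Longrightarrow> (\<lambda>x. c * f x) \<in> Cc_real"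
  by (rule Cc_real_compose[where h = "\<lambda>y. c * y"]) (auto intro!: continuous_intros)

lemma Cc_real_mult_left:
  fixes f g :: "'a::t2_space \<Rightarrow> real"
  assumes "f \<in> Cc_real" "continuous_on UNIV g"
  shows "(\<lambda>x. f x * g x) \<in> Cc_real"
proof -
  obtain K where K: "continuous_on UNIV f" "compact K" "\<And>x. x \<notin> K \<Longrightarrow> f x = 0"
    using assms(1) by (metis Cc_realE)
  show ?thesis
    using K assms(2) by (intro Cc_realI[of _ K] continuous_intros) auto
qed

lemma Cc_real_sum:
  fixes f :: "'i \<Rightarrow> 'a::t2_space \<Rightarrow> real"
  assumes "\<And>i. i \<in> A \<Longrightarrow> f i \<in> Cc_real"
  shows "(\<lambda>x. \<Sum>i\<in>A. f i x) \<in> Cc_real"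
proof (cases "finite A")
  case True
  then show ?thesis using assms
    by (induction A) (auto intro: Cc_realI[of _ "{}"] Cc_real_add)
qed (auto intro: Cc_realI[of _ "{}"])

text \<open>
  The form of Urysohn's lemma that the construction uses: the function equals $1$ on a whole
  neighbourhood \<open>W\<close> of \<open>K\<close>, so that multiplication by \<open>1 - h\<close> moves supports away from \<open>K\<close>.
\<close>

lemma Urysohn_compact_support:
  fixes K U :: "'a::t2_space set"
  assumes lc: "locally_compact_space (euclidean :: 'a topology)"
    and "compact K" "open U" "K \<subseteq> U"
  obtains h W where "h \<in> Cc_real" "\<And>x. 0 \<le> h x" "\<And>x. h x \<le> 1" "closure {x. h x \<noteq> 0} \<subseteq> U"
    "open W" "K \<subseteq> W" "\<And>x. x \<in> W \<Longrightarrow> h x = 1"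
proof -
  have "Hausdorff_space (euclidean :: 'a topology)"
    unfolding Hausdorff_space_def disjnt_def using hausdorff by fastforce
  then have regular: "regular_space (euclidean :: 'a topology)"
    using lc locally_compact_Hausdorff_imp_regular_space by blast
  have creg: "completely_regular_space (euclidean :: 'a topology)"
    using lc regular by (intro locally_compact_regular_imp_completely_regular_space) auto
  have nbhd: "\<exists>W L. open W \<and> compact L \<and> C \<subseteq> W \<and> W \<subseteq> L \<and> L \<subseteq> U" if "compact C" "C \<subseteq> U" for C
  proof -
    have "neighbourhood_base_of (compactin euclidean) (euclidean :: 'a topology)"
      using lc regular by (simp add: locally_compact_imp_neighbourhood_base)
    then have "\<forall>x\<in>C. \<exists>W L. open W \<and> compact L \<and> x \<in> W \<and> W \<subseteq> L \<and> L \<subseteq> U"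
      unfolding neighbourhood_base_of using \<open>open U\<close> that
      by (metis compactin_euclidean_iff open_openin subsetD)
    then obtain W L where WL: "\<And>x. x \<in> C \<Longrightarrow> open (W x) \<and> compact (L x) \<and> x \<in> W x \<and> W x \<subseteq> L x \<and> L x \<subseteq> U"
      by metis
    obtain D where D: "D \<subseteq> C" "finite D" "C \<subseteq> (\<Union>x\<in>D. W x)"
      using \<open>compact C\<close> by (rule compactE_image[of C C W]) (use WL in blast)+
    have "open (\<Union>x\<in>D. W x)" "compact (\<Union>x\<in>D. L x)" "(\<Union>x\<in>D. W x) \<subseteq> (\<Union>x\<in>D. L x)" "(\<Union>x\<in>D. L x) \<subseteq> U"
      using WL D by (auto intro!: compact_UN)
    then show ?thesis using D by blast
  qed
  obtain W L where W: "open W" "compact L" "K \<subseteq> W" "W \<subseteq> L" "L \<subseteq> U"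
    using nbhd assms by metis
  obtain W' L' where W': "open W'" "compact L'" "L \<subseteq> W'" "W' \<subseteq> L'" "L' \<subseteq> U"
    using nbhd W by metis
  obtain h where h: "continuous_map euclidean (top_of_set {0..1::real}) h"
    "h ` (- W') \<subseteq> {0}" "h ` L \<subseteq> {1}"
    by (rule Urysohn_completely_regular_compact_closed[of 0 1 "euclidean :: 'a topology" L "- W'"])
      (use creg W W' in \<open>auto simp: disjnt_def closed_Compl\<close>)
  have cont: "continuous_on UNIV h" and h01: "h x \<in> {0..1}" for x
    using h(1) by (auto simp: continuous_map_in_subtopology)
  have out: "x \<notin> L' \<Longrightarrow> h x = 0" for x
    using h(2) W' by auto
  have one: "x \<in> W \<Longrightarrow> h x = 1" for x
    using h(3) W by blast
  have "closure {x. h x \<noteq> 0} \<subseteq> L'"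
    using out W' by (intro closure_minimal compact_imp_closed) auto
  then show thesis
    using h01 out one W W' cont by (intro that[of h W] Cc_realI[of h L']) auto
qed

section \<open>The outer measure of a positive functional\<close>

locale positive_real_functional =
  fixes I :: "('a::t2_space \<Rightarrow> real) \<Rightarrow> real"
  assumes locally_compact: "locally_compact_space (euclidean :: 'a topology)"
    and add: "\<lbrakk>f \<in> Cc_real; g \<in> Cc_real\<rbrakk> \<Longrightarrow> I (\<lambda>x. f x + g x) = I f + I g"
    and cmult: "f \<in> Cc_real \<Longrightarrow> I (\<lambda>x. c * f x) = c * I f"
    and nonneg: "\<lbrakk>f \<in> Cc_real; \<And>x. 0 \<le> f x\<rbrakk> \<Longrightarrow> 0 \<le> I f"
begin

lemma mono:
  assumes "f \<in> Cc_real" "g \<in> Cc_real" "\<And>x. f x \<le> g x"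
  shows "I f \<le> I g"
proof -
  have d: "(\<lambda>x. g x + (-1) * f x) \<in> Cc_real"
    by (intro Cc_real_add Cc_real_cmult assms)
  have "0 \<le> I (\<lambda>x. g x + (-1) * f x)"
    using assms by (intro nonneg[OF d]) simp
  also have "\<dots> = I g + (-1) * I f"
    using add[of g "\<lambda>x. (-1) * f x", OF assms(2) Cc_real_cmult[OF assms(1)]] cmult[OF assms(1), of "-1"]
    by simp
  finally show ?thesis by simp
qed

lemma zero [simp]: "I (\<lambda>x. 0) = 0"
proof -
  have "(\<lambda>x::'a. 0::real) \<in> Cc_real" by (intro Cc_realI[of _ "{}"]) auto
  from cmult[OF this, of 0] show ?thesis by simp
qed

lemma sum:
  assumes "\<And>i. i \<in> A \<Longrightarrow> f i \<in> Cc_real"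
  shows "I (\<lambda>x. \<Sum>i\<in>A. f i x) = (\<Sum>i\<in>A. I (f i))"
proof (cases "finite A")
  case True
  then show ?thesis using assms
    by (induction A) (auto simp: add Cc_real_sum)
qed simp

text \<open>
  The support, and not merely the set where \<open>f\<close> is non-zero, is required to lie inside \<open>U\<close>: it
  is compact, so finitely many members of an open cover of \<open>U\<close> already cover it.
\<close>

definition subordinate :: "('a \<Rightarrow> real) \<Rightarrow> 'a set \<Rightarrow> bool" (infix \<open>\<sqsubset>\<close> 50) where
  "f \<sqsubset> U \<longleftrightarrow> f \<in> Cc_real \<and> (\<forall>x. 0 \<le> f x \<and> f x \<le> 1) \<and> closure {x. f x \<noteq> 0} \<subseteq> U"

text \<open>
  The measure of an open set is forced: it has to be the supremum of the values of the functional
  on functions below the indicator of the set. Outer regularity then forces the definition of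
  \<open>outer\<close>.
\<close>

definition content :: "'a set \<Rightarrow> ennreal" where
  "content U = (SUP f\<in>{f. f \<sqsubset> U}. ennreal (I f))"

definition outer :: "'a set \<Rightarrow> ennreal" where
  "outer E = (INF U\<in>{U. open U \<and> E \<subseteq> U}. content U)"

lemma subordinate_le_1: "f \<sqsubset> U \<Longrightarrow> f x \<le> 1"
  and subordinate_support: "f \<sqsubset> U \<Longrightarrow> closure {x. f x \<noteq> 0} \<subseteq> U"
  by (auto simp: subordinate_def)

lemma subordinate_outside: "f \<sqsubset> U \<Longrightarrow> x \<notin> U \<Longrightarrow> f x = 0"
  using subordinate_support closure_subset[of "{x. f x \<noteq> 0}"] by blast

lemma subordinate_zero: "(\<lambda>x. 0) \<sqsubset> U"
  by (auto simp: subordinate_def intro: Cc_realI[of _ "{}"])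

lemma le_content: "f \<sqsubset> U \<Longrightarrow> ennreal (I f) \<le> content U"
  by (auto simp: content_def intro: SUP_upper)

lemma content_mono: "U \<subseteq> V \<Longrightarrow> content U \<le> content V"
  unfolding content_def by (intro SUP_subset_mono) (auto simp: subordinate_def)

lemma content_empty [simp]: "content {} = 0"
proof -
  have "f \<sqsubset> {} \<Longrightarrow> f = (\<lambda>x. 0)" for f
    using subordinate_outside by blast
  then have "{f. f \<sqsubset> {}} = {\<lambda>x. 0}"
    using subordinate_zero by auto
  then show ?thesis
    by (simp add: content_def)
qed

lemma outer_le_content: "open U \<Longrightarrow> E \<subseteq> U \<Longrightarrow> outer E \<le> content U"
  by (auto simp: outer_def intro: INF_lower)

lemma outer_open: "open U \<Longrightarrow> outer U = content U"
  by (intro antisym outer_le_content) (auto simp: outer_def intro!: INF_greatest content_mono)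

lemma outer_mono: "E \<subseteq> F \<Longrightarrow> outer E \<le> outer F"
  unfolding outer_def by (intro INF_superset_mono) auto

lemma outer_less_obtain:
  assumes "outer E < c"
  obtains U where "open U" "E \<subseteq> U" "content U < c"
  using assms unfolding outer_def INF_less_iff by blast

text \<open>
  A function \<open>f\<close> subordinate to \<open>U \<union> V\<close> splits as \<open>f h + f (1 - h)\<close>, where \<open>h\<close> is supported in \<open>U\<close>
  and equals $1$ near the part of the support of \<open>f\<close> outside \<open>V\<close>. This is a partition of unity
  with two members.
\<close>

lemma content_Un:
  assumes "open U" "open V"
  shows "content (U \<union> V) \<le> content U + content V"
  unfolding content_def[of "U \<union> V"]
proof (rule SUP_least, clarify)
  fix f assume f: "f \<sqsubset> U \<union> V"
  define K where "K = closure {x. f x \<noteq> 0}"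
  have K: "compact K" "closed K" "K \<subseteq> U \<union> V" and outK: "\<And>x. x \<notin> K \<Longrightarrow> f x = 0"
    using f closure_subset[of "{x. f x \<noteq> 0}"]
    by (auto simp: K_def subordinate_def Cc_real_def)
  have "compact (K - V)" "K - V \<subseteq> U"
    using K assms by (auto simp: compact_diff)
  then obtain h W where h: "h \<in> Cc_real" "\<And>x. 0 \<le> h x" "\<And>x. h x \<le> 1" "closure {x. h x \<noteq> 0} \<subseteq> U"
    and W: "open W" "K - V \<subseteq> W" "\<And>x. x \<in> W \<Longrightarrow> h x = 1"
    using Urysohn_compact_support[OF locally_compact _ \<open>open U\<close>] by metis
  have conth: "continuous_on UNIV h"
    using h(1) by (simp add: Cc_real_def)
  have f': "f \<in> Cc_real" "\<And>x. 0 \<le> f x" "\<And>x. f x \<le> 1"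
    using f by (auto simp: subordinate_def)
  have "closure {x. f x * h x \<noteq> 0} \<subseteq> closure {x. h x \<noteq> 0}"
    by (intro closure_mono) auto
  then have fh: "(\<lambda>x. f x * h x) \<sqsubset> U"
    unfolding subordinate_def using f' h(2-4) Cc_real_mult_left[OF f'(1) conth]
    by (metis mult_le_one mult_nonneg_nonneg order_trans)
  have "closure {x. f x * (1 - h x) \<noteq> 0} \<subseteq> K - W"
    using outK W K by (intro closure_minimal closed_Diff) force+
  then have "closure {x. f x * (1 - h x) \<noteq> 0} \<subseteq> V"
    using W K by blast
  then have fh': "(\<lambda>x. f x * (1 - h x)) \<sqsubset> V"
    unfolding subordinate_def
  proof (intro conjI allI)
    show "(\<lambda>x. f x * (1 - h x)) \<in> Cc_real"
      by (intro Cc_real_mult_left f' continuous_intros conth)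
    show "0 \<le> f x * (1 - h x)" "f x * (1 - h x) \<le> 1" for x
      using f'(2,3)[of x] h(2,3)[of x] by (auto intro: mult_le_one)
  qed
  have "I f = I (\<lambda>x. f x * h x + f x * (1 - h x))"
    by (simp add: algebra_simps)
  also have "\<dots> = I (\<lambda>x. f x * h x) + I (\<lambda>x. f x * (1 - h x))"
    using fh fh' by (intro add) (auto simp: subordinate_def)
  finally have "ennreal (I f) = ennreal (I (\<lambda>x. f x * h x)) + ennreal (I (\<lambda>x. f x * (1 - h x)))"
    using fh fh' by (auto simp: subordinate_def intro!: ennreal_plus nonneg)
  also have "\<dots> \<le> content U + content V"
    using fh fh' by (intro add_mono le_content)
  finally show "ennreal (I f) \<le> content U + content V" .
qed

lemma content_UN_le_suminf:
  fixes A :: "nat \<Rightarrow> 'a set"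
  assumes "\<And>i. open (A i)"
  shows "content (\<Union>i. A i) \<le> (\<Sum>i. content (A i))"
  unfolding content_def[of "\<Union>i. A i"]
proof (rule SUP_least, clarify)
  fix f assume f: "f \<sqsubset> (\<Union>i. A i)"
  have fin: "content (\<Union>i<n. A i) \<le> (\<Sum>i<n. content (A i))" for n
  proof (induction n)
    case (Suc n)
    have "content (\<Union>i<Suc n. A i) \<le> content (\<Union>i<n. A i) + content (A n)"
      using content_Un[of "\<Union>i<n. A i" "A n"] assms by (auto simp: lessThan_Suc Un_commute)
    also have "\<dots> \<le> (\<Sum>i<Suc n. content (A i))"
      using Suc.IH by (simp add: add_right_mono)
    finally show ?case .
  qed simp
  have "compact (closure {x. f x \<noteq> 0})"
    using f by (simp add: subordinate_def Cc_real_def)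
  then obtain D where D: "finite D" "closure {x. f x \<noteq> 0} \<subseteq> (\<Union>i\<in>D. A i)"
    by (rule compactE_image[of "closure {x. f x \<noteq> 0}" UNIV A])
      (use f assms in \<open>auto simp: subordinate_def\<close>)
  obtain n where n: "D \<subseteq> {..<n}"
    using D(1) finite_nat_iff_bounded by blast
  have "(\<Union>i\<in>D. A i) \<subseteq> (\<Union>i<n. A i)"
    using n by blast
  then have "f \<sqsubset> (\<Union>i<n. A i)"
    using f D unfolding subordinate_def by (meson order_trans)
  then have "ennreal (I f) \<le> (\<Sum>i<n. content (A i))"
    by (rule order_trans[OF le_content fin])
  also have "\<dots> \<le> (\<Sum>i. content (A i))"
    by (intro sum_le_suminf) auto
  finally show "ennreal (I f) \<le> (\<Sum>i. content (A i))" .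
qed

text \<open>
  Countable subadditivity passes from open sets to arbitrary sets by covering the \<open>n\<close>-th set up to
  an error \<open>e / 2^(n+1)\<close>.
\<close>

lemma outer_measure_space_outer: "outer_measure_space (Pow UNIV) outer"
  unfolding outer_measure_space_def
proof (intro conjI)
  show "positive (Pow UNIV) outer"
    using outer_open[of "{}"] by (simp add: positive_def)
  show "increasing (Pow UNIV) outer"
    by (auto simp: increasing_def intro: outer_mono)
  show "countably_subadditive (Pow UNIV) outer"
    unfolding countably_subadditive_def
  proof (intro allI impI)
    fix A :: "nat \<Rightarrow> 'a set"
    show "outer (\<Union>i. A i) \<le> (\<Sum>i. outer (A i))"
    proof (rule ennreal_le_epsilon)
      fix e :: real assume e: "0 < e" and "(\<Sum>n. outer (A n)) < top"
      then have *: "outer (A n) < outer (A n) + e * (1/2)^Suc n" for n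
        by (auto simp add: less_top dest!: ennreal_suminf_lessD)
      have "\<exists>U. open U \<and> A n \<subseteq> U \<and> content U \<le> outer (A n) + e * (1/2)^Suc n" for n
        using outer_less_obtain[OF *[of n]] by (metis less_imp_le)
      then obtain U where U: "\<And>n. open (U n)" "\<And>n. A n \<subseteq> U n"
        "\<And>n. content (U n) \<le> outer (A n) + e * (1/2)^Suc n"
        by metis
      have "outer (\<Union>i. A i) \<le> content (\<Union>i. U i)"
        using U by (intro outer_le_content) auto
      also have "\<dots> \<le> (\<Sum>i. content (U i))"
        using U by (intro content_UN_le_suminf)
      also have "\<dots> \<le> (\<Sum>n. outer (A n) + e * (1/2) ^ Suc n)"
        using U by (intro suminf_le) auto
      also have "\<dots> = (\<Sum>n. outer (A n)) + (\<Sum>n. ennreal e * ennreal ((1/2) ^ Suc n))"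
        using e by (subst suminf_add[symmetric])
          (auto simp del: ennreal_suminf_cmult simp add: ennreal_mult[symmetric])
      also have "\<dots> = (\<Sum>n. outer (A n)) + e"
        unfolding ennreal_suminf_cmult
        by (subst suminf_ennreal_eq[OF zero_le_power power_half_series]) auto
      finally show "outer (\<Union>i. A i) \<le> (\<Sum>n. outer (A n)) + e" .
    qed
  qed
qed

lemma outer_subadditive: "outer (A \<union> B) \<le> outer A + outer B"
proof -
  have pos: "positive (Pow UNIV) outer" and "countably_subadditive (Pow UNIV) outer"
    using outer_measure_space_outer by (auto simp: outer_measure_space_def)
  then have "subadditive (Pow UNIV) outer"
    using ring_of_sets.countably_subadditive_subadditive[of UNIV "Pow UNIV" outer]
      algebra.axioms(1) algebra_Pow by blast
  then have "outer (A \<union> (B - A)) \<le> outer A + outer (B - A)"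
    unfolding subadditive_def by blast
  also have "\<dots> \<le> outer A + outer B"
    by (intro add_left_mono outer_mono) auto
  finally show ?thesis by simp
qed

text \<open>
  Open sets satisfy Caratheodory's criterion. It suffices to split open test sets \<open>V\<close>. If \<open>f\<close> is
  subordinate to \<open>V \<inter> U\<close> and \<open>g\<close> to the open set obtained from \<open>V\<close> by removing the support of
  \<open>f\<close>, then the two are non-zero at no common point, so \<open>f + g\<close> is subordinate to \<open>V\<close>; the suprema
  over \<open>g\<close> and then over \<open>f\<close> give the inequality that subadditivity does not.
\<close>

lemma open_in_lambda_system:
  assumes "open U"
  shows "U \<in> lambda_system UNIV (Pow UNIV) outer"
proof -
  have open_case: "outer (V \<inter> U) + outer (V - U) \<le> content V" if "open V" for V
  proof -
    have "ennreal (I f) + outer (V - U) \<le> content V" if f: "f \<sqsubset> V \<inter> U" for f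
    proof -
      define K where "K = closure {x. f x \<noteq> 0}"
      have K: "closed K" "K \<subseteq> V \<inter> U"
        using f by (auto simp: K_def subordinate_def)
      have "outer (V - U) \<le> content (V - K)"
        using K \<open>open V\<close> by (intro outer_le_content) auto
      then have "ennreal (I f) + outer (V - U) \<le> ennreal (I f) + content (V - K)"
        by (rule add_left_mono)
      also have "\<dots> = (SUP g\<in>{g. g \<sqsubset> V - K}. ennreal (I f) + ennreal (I g))"
        unfolding content_def using subordinate_zero by (subst ennreal_SUP_add_right) auto
      also have "\<dots> \<le> content V"
      proof (rule SUP_least, clarify)
        fix g assume g: "g \<sqsubset> V - K"
        have "f x + g x \<le> 1" for x
          using subordinate_outside[OF g, of x] subordinate_le_1[OF f, of x] subordinate_le_1[OF g, of x]
            closure_subset[of "{x. f x \<noteq> 0}"] by (cases "f x = 0") (auto simp: K_def)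
        moreover have "closure {x. f x + g x \<noteq> 0} \<subseteq> closure ({x. f x \<noteq> 0} \<union> {x. g x \<noteq> 0})"
          by (intro closure_mono) auto
        then have "closure {x. f x + g x \<noteq> 0} \<subseteq> V"
          using subordinate_support[OF f] subordinate_support[OF g] by auto
        ultimately have "(\<lambda>x. f x + g x) \<sqsubset> V"
          using f g by (auto simp: subordinate_def Cc_real_add)
        then have "ennreal (I (\<lambda>x. f x + g x)) \<le> content V"
          by (rule le_content)
        then show "ennreal (I f) + ennreal (I g) \<le> content V"
          using f g add[of f g] by (simp add: subordinate_def nonneg)
      qed
      finally show ?thesis .
    qed
    then have "(SUP f\<in>{f. f \<sqsubset> V \<inter> U}. ennreal (I f) + outer (V - U)) \<le> content V"
      by (auto intro: SUP_least)
    then show ?thesis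
      using \<open>open V\<close> assms subordinate_zero
      by (subst (asm) ennreal_SUP_add_left) (auto simp: outer_open content_def open_Int)
  qed
  have "outer (E \<inter> U) + outer (E - U) \<le> outer E" for E
    unfolding outer_def[of E]
  proof (rule INF_greatest, clarify)
    fix V assume V: "open V" "E \<subseteq> V"
    have "outer (E \<inter> U) + outer (E - U) \<le> outer (V \<inter> U) + outer (V - U)"
      using V by (intro add_mono outer_mono) auto
    also have "\<dots> \<le> content V"
      using V by (intro open_case)
    finally show "outer (E \<inter> U) + outer (E - U) \<le> content V" .
  qed
  moreover have "outer E \<le> outer (E \<inter> U) + outer (E - U)" for E
    using outer_subadditive[of "E \<inter> U" "E - U"] by (simp add: Int_Diff_Un)
  ultimately show ?thesis
    unfolding algebra.lambda_system_eq[OF algebra_Pow] by (auto intro: antisym)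
qed

definition riesz_measure :: "'a measure" where
  "riesz_measure = measure_of UNIV (sets borel) outer"

lemma sets_riesz_measure: "sets riesz_measure = sets borel"
  using sets.sets_measure_of_eq[of borel] by (simp add: riesz_measure_def)

lemma emeasure_riesz_measure:
  assumes "E \<in> sets borel"
  shows "emeasure riesz_measure E = outer E"
proof -
  let ?L = "lambda_system UNIV (Pow UNIV) outer"
  have L: "measure_space UNIV ?L outer"
    using sigma_algebra.caratheodory_lemma[OF sigma_algebra_Pow outer_measure_space_outer] by simp
  have "sigma_sets UNIV {S::'a set. open S} \<subseteq> ?L"
    using L open_in_lambda_system
    by (intro sigma_algebra.sigma_sets_subset) (auto simp: measure_space_def)
  then have "measure_space UNIV (sets borel) outer"
    using L sets.sigma_algebra_axioms[of borel]
    by (intro measure_down[OF L]) (auto simp: sets_borel)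
  then show ?thesis
    unfolding riesz_measure_def using assms
    by (intro emeasure_measure_of_sigma) (auto simp: measure_space_def)
qed

text \<open>
  For \<open>0 < t < 1\<close> the set where \<open>h > t\<close> is an open neighbourhood of \<open>K\<close>, and every function
  subordinate to it lies below \<open>h / t\<close>; now \<open>t\<close> tends to $1$. Together with \<open>le_outer_support\<close> this
  encloses the outer measure of a compact set between values of the functional.
\<close>

lemma outer_le_of_ge_one:
  assumes h: "h \<in> Cc_real" "\<And>x. 0 \<le> h x" and K: "\<And>x. x \<in> K \<Longrightarrow> 1 \<le> h x"
  shows "outer K \<le> ennreal (I h)"
proof -
  have bound: "outer K \<le> ennreal (I h / t)" if t: "0 < t" "t < 1" for t
  proof -
    have "open {x. t < h x}"
      using h(1) by (auto simp: Cc_real_def intro!: open_Collect_less)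
    then have "outer K \<le> content {x. t < h x}"
      using K t by (intro outer_le_content) force+
    also have "\<dots> \<le> ennreal (I h / t)"
      unfolding content_def
    proof (rule SUP_least, clarify)
      fix f assume f: "f \<sqsubset> {x. t < h x}"
      have "f x \<le> (1 / t) * h x" for x
      proof (cases "t < h x")
        case True
        then have "t * f x \<le> h x"
          using mult_left_mono[OF subordinate_le_1[OF f, of x] less_imp_le[OF t(1)]] by linarith
        then show ?thesis using t by (simp add: field_simps)
      next
        case False
        then have "f x = 0" using subordinate_outside[OF f] by simp
        then show ?thesis using t h(2)[of x] by simp
      qed
      then have "I f \<le> I (\<lambda>x. (1 / t) * h x)"
        using f h by (intro mono Cc_real_cmult) (auto simp: subordinate_def)
      then show "ennreal (I f) \<le> ennreal (I h / t)"
        using h t cmult[of h "1 / t"] by (intro ennreal_leI) simp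
    qed
    finally show ?thesis .
  qed
  show ?thesis
  proof (rule ennreal_le_epsilon)
    fix e :: real assume e: "0 < e"
    have I0: "0 \<le> I h" using h by (rule nonneg)
    \<comment> \<open>This value of t satisfies (I h + 1) / t = I h + 1 + e, hence I h / t \<open>\<le>\<close> I h + e.\<close>
    define t where "t = (I h + 1) / (I h + 1 + e)"
    have t: "0 < t" "t < 1" using e I0 by (auto simp: t_def)
    have "I h / t \<le> I h + e"
      using e I0 by (auto simp: t_def field_simps)
    then have "outer K \<le> ennreal (I h + e)"
      using bound[OF t] by (meson ennreal_leI order_trans)
    then show "outer K \<le> ennreal (I h) + ennreal e"
      using e I0 by simp
  qed
qed

lemma le_outer_support: "f \<sqsubset> UNIV \<Longrightarrow> ennreal (I f) \<le> outer (closure {x. f x \<noteq> 0})"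
  unfolding outer_def by (intro INF_greatest le_content) (auto simp: subordinate_def)

text \<open>
  Compact sets have finite measure by \<open>outer_le_of_ge_one\<close>, applied to a Urysohn function. Outer
  regularity is built into \<open>outer\<close>. Inner regularity holds because a function subordinate to \<open>U\<close>
  has compact support inside \<open>U\<close>, whose measure is at least the value of the functional
  (\<open>le_outer_support\<close>).
\<close>

lemma radon_measure_riesz_measure: "radon_measure riesz_measure"
  unfolding radon_measure_def
proof (intro conjI ballI allI impI)
  show "sets riesz_measure = sets borel"
    by (rule sets_riesz_measure)
next
  fix K :: "'a set" assume K: "compact K"
  obtain h W where h: "h \<in> Cc_real" "\<And>x. 0 \<le> h x" "\<And>x. h x \<le> 1" "closure {x. h x \<noteq> 0} \<subseteq> UNIV"
    and W: "open W" "K \<subseteq> W" "\<And>x. x \<in> W \<Longrightarrow> h x = 1"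
    using Urysohn_compact_support[OF locally_compact K open_UNIV subset_UNIV] by metis
  have "outer K \<le> ennreal (I h)"
    using h(1,2) W by (intro outer_le_of_ge_one) auto
  moreover have "K \<in> sets borel"
    using K by (simp add: borel_closed compact_imp_closed)
  ultimately show "emeasure riesz_measure K < \<infinity>"
    by (simp add: emeasure_riesz_measure order_le_less_trans)
next
  fix E :: "'a set" assume E: "E \<in> sets borel"
  show "emeasure riesz_measure E = (INF U\<in>{U. open U \<and> E \<subseteq> U}. emeasure riesz_measure U)"
    unfolding emeasure_riesz_measure[OF E] outer_def[of E]
    by (intro INF_cong) (auto simp: outer_open emeasure_riesz_measure)
next
  fix U :: "'a set" assume U: "open U"
  have borelK: "K \<in> sets borel" if "compact K" for K :: "'a set"
    using that by (simp add: borel_closed compact_imp_closed)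
  show "emeasure riesz_measure U = (SUP K\<in>{K. compact K \<and> K \<subseteq> U}. emeasure riesz_measure K)"
  proof (rule antisym)
    show "emeasure riesz_measure U \<le> (SUP K\<in>{K. compact K \<and> K \<subseteq> U}. emeasure riesz_measure K)"
      unfolding emeasure_riesz_measure[OF borel_open[OF U]] outer_open[OF U] content_def
    proof (rule SUP_least, clarify)
      fix f assume f: "f \<sqsubset> U"
      let ?K = "closure {x. f x \<noteq> 0}"
      have K: "compact ?K" "?K \<subseteq> U"
        using f by (auto simp: subordinate_def Cc_real_def)
      have "ennreal (I f) \<le> emeasure riesz_measure ?K"
        using f le_outer_support[of f] K borelK by (simp add: emeasure_riesz_measure subordinate_def)
      also have "\<dots> \<le> (SUP K\<in>{K. compact K \<and> K \<subseteq> U}. emeasure riesz_measure K)"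
        using K by (intro SUP_upper) auto
      finally show "ennreal (I f) \<le> (SUP K\<in>{K. compact K \<and> K \<subseteq> U}. emeasure riesz_measure K)" .
    qed
    show "(SUP K\<in>{K. compact K \<and> K \<subseteq> U}. emeasure riesz_measure K) \<le> emeasure riesz_measure U"
      using U by (intro SUP_least emeasure_mono) (auto simp: sets_riesz_measure)
  qed
qed

end

section \<open>Comparing two positive functionals\<close>

text \<open>
  The \<open>k\<close>-th summand is the part of \<open>y\<close> that lies between the heights \<open>k\<close> and \<open>k + 1\<close>.
\<close>

lemma sum_unit_slices:
  fixes y :: real
  assumes "0 \<le> y"
  shows "(\<Sum>k<n. min 1 (max 0 (y - real k))) = min (real n) y"
proof (induction n)
  case (Suc n)
  then show ?case using assms by (simp add: min_def max_def)
qed (use assms in simp)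

text \<open>
  The assumption \<open>le\<close> says that \<open>I f \<le> J g\<close> as soon as an indicator function fits between \<open>f\<close> and \<open>g\<close>. Cut
  \<open>n F\<close> into horizontal slices \<open>s k\<close> of height $1$: wherever a slice is non-zero, the slice below
  it has already reached $1$, so \<open>I (s (k + 1)) \<le> J (s k)\<close>. Summing gives
  \<open>n I F \<le> J h + n J F\<close>, where \<open>h\<close> serves as the slice below the lowest one and does not depend
  on \<open>n\<close>. Dividing by \<open>n\<close> removes it.
\<close>

lemma positive_real_functional_le:
  fixes I J :: "('a::t2_space \<Rightarrow> real) \<Rightarrow> real"
  assumes "positive_real_functional I" "positive_real_functional J"
    and le: "\<And>f g. \<lbrakk>f \<in> Cc_real; \<And>x. 0 \<le> f x; \<And>x. f x \<le> 1; g \<in> Cc_real; \<And>x. 0 \<le> g x;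
               \<And>x. f x \<noteq> 0 \<Longrightarrow> g x = 1\<rbrakk> \<Longrightarrow> I f \<le> J g"
    and F: "F \<in> Cc_real" "\<And>x. 0 \<le> F x"
  shows "I F \<le> J F"
proof -
  interpret I: positive_real_functional I by fact
  interpret J: positive_real_functional J by fact
  obtain K where K: "continuous_on UNIV F" "compact K" "\<And>x. x \<notin> K \<Longrightarrow> F x = 0"
    using F(1) by (metis Cc_realE)
  obtain h W where h: "h \<in> Cc_real" "\<And>x. 0 \<le> h x" and W: "K \<subseteq> W" "\<And>x. x \<in> W \<Longrightarrow> h x = (1::real)"
    using Urysohn_compact_support[OF I.locally_compact K(2) open_UNIV subset_UNIV] by metis
  have "bounded (F ` K)"
    using K by (meson compact_continuous_image compact_imp_bounded continuous_on_subset subset_UNIV)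
  then obtain B where "\<forall>x\<in>K. \<bar>F x\<bar> \<le> B"
    unfolding bounded_iff by auto
  then have B: "F x \<le> max 0 B" for x
    using K(3)[of x] by (cases "x \<in> K") (auto simp: le_max_iff_disj)
  have step: "real n * I F \<le> J h + real n * J F" for n
  proof -
    define s where "s k x = min 1 (max 0 (real n * F x - real k))" for k x
    define N where "N = nat \<lceil>real n * max 0 B\<rceil>"
    have sC: "s k \<in> Cc_real" for k
      unfolding s_def
      by (rule Cc_real_compose[OF F(1), where h = "\<lambda>y. min 1 (max 0 (real n * y - real k))"])
        (auto intro!: continuous_intros)
    have s0: "0 \<le> s k x" and s1: "s k x \<le> 1" for k x
      by (auto simp: s_def)
    have "real n * F x \<le> real N" for x
      using mult_left_mono[OF B[of x], of "real n"] unfolding N_def by linarith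
    then have sum_s: "(\<Sum>k<N. s k x) = real n * F x" for x
      unfolding s_def using F(2) by (subst sum_unit_slices) auto
    have first: "I (s 0) \<le> J h"
    proof (rule le)
      fix x assume "s 0 x \<noteq> 0"
      then have "F x \<noteq> 0" by (auto simp: s_def)
      then show "h x = 1" using K(3) W by blast
    qed (use h sC s0 s1 in auto)
    have succ: "I (s (Suc k)) \<le> J (s k)" for k
    proof (rule le)
      fix x assume "s (Suc k) x \<noteq> 0"
      then show "s k x = 1" by (auto simp: s_def min_def max_def split: if_splits)
    qed (use sC s0 s1 in auto)
    have shift: "(\<Sum>k<M. I (s k)) \<le> J h + (\<Sum>k<M. J (s k))" for M
    proof (cases M)
      case 0
      then show ?thesis using h by (simp add: J.nonneg)
    next
      case (Suc m)
      have "(\<Sum>k<M. I (s k)) = I (s 0) + (\<Sum>k<m. I (s (Suc k)))"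
        unfolding Suc by (rule sum.lessThan_Suc_shift)
      also have "\<dots> \<le> J h + (\<Sum>k<m. J (s k))"
        using first succ by (intro add_mono sum_mono)
      also have "\<dots> \<le> J h + (\<Sum>k<M. J (s k))"
        unfolding Suc using J.nonneg[OF sC s0] by simp
      finally show ?thesis .
    qed
    have "real n * I F = I (\<lambda>x. \<Sum>k<N. s k x)"
      unfolding sum_s using I.cmult[OF F(1)] by simp
    also have "\<dots> = (\<Sum>k<N. I (s k))"
      using sC by (intro I.sum)
    also have "\<dots> \<le> J h + (\<Sum>k<N. J (s k))"
      by (rule shift)
    also have "(\<Sum>k<N. J (s k)) = J (\<lambda>x. \<Sum>k<N. s k x)"
      using sC by (intro J.sum[symmetric])
    also have "\<dots> = real n * J F"
      unfolding sum_s using J.cmult[OF F(1)] by simp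
    finally show ?thesis .
  qed
  show ?thesis
  proof (rule ccontr)
    assume "\<not> I F \<le> J F"
    then obtain n where "J h < real n * (I F - J F)"
      using reals_Archimedean3[of "I F - J F"] by auto
    then show False using step[of n] by (simp add: algebra_simps)
  qed
qed

section \<open>Integration against Radon measures\<close>

lemma radon_sets: "radon_measure \<mu> \<Longrightarrow> sets \<mu> = sets borel"
  by (simp add: radon_measure_def)

lemma radon_outer_regular:
  "radon_measure \<mu> \<Longrightarrow> E \<in> sets borel \<Longrightarrow>
    emeasure \<mu> E = (INF U\<in>{U. open U \<and> E \<subseteq> U}. emeasure \<mu> U)"
  unfolding radon_measure_def by blast

lemma radon_inner_regular:
  "radon_measure \<mu> \<Longrightarrow> open U \<Longrightarrow>
    emeasure \<mu> U = (SUP K\<in>{K. compact K \<and> K \<subseteq> U}. emeasure \<mu> K)"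
  unfolding radon_measure_def by blast

lemma compact_in_sets_radon:
  fixes \<mu> :: "'a::t2_space measure"
  shows "radon_measure \<mu> \<Longrightarrow> compact K \<Longrightarrow> K \<in> sets \<mu>"
  by (simp add: radon_sets borel_closed compact_imp_closed)

lemma emeasure_compact_finite: "radon_measure \<mu> \<Longrightarrow> compact K \<Longrightarrow> emeasure \<mu> K < \<infinity>"
  by (simp add: radon_measure_def)

lemma integrable_compact_support:
  fixes f :: "'a::t2_space \<Rightarrow> 'b::{banach, second_countable_topology}"
  assumes \<mu>: "radon_measure \<mu>"
    and K: "continuous_on UNIV f" "compact K" "\<And>x. x \<notin> K \<Longrightarrow> f x = 0"
  shows "integrable \<mu> f"
proof -
  have "bounded (f ` K)"
    using K by (meson compact_continuous_image compact_imp_bounded continuous_on_subset subset_UNIV)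
  then obtain B where B: "\<forall>x\<in>K. norm (f x) \<le> B"
    unfolding bounded_iff by auto
  have "f \<in> borel_measurable borel"
    using K(1) by (rule borel_measurable_continuous_onI)
  then have "f \<in> borel_measurable \<mu>"
    using measurable_cong_sets[OF radon_sets[OF \<mu>] refl] by blast
  then show ?thesis
    using B K(3) emeasure_compact_finite[OF \<mu> K(2)] compact_in_sets_radon[OF \<mu> K(2)]
    by (intro integrableI_bounded_set[of K _ _ B]) auto
qed

lemma integrable_Cc_real:
  fixes f :: "'a::t2_space \<Rightarrow> real"
  shows "radon_measure \<mu> \<Longrightarrow> f \<in> Cc_real \<Longrightarrow> integrable \<mu> f"
  by (erule Cc_realE) (rule integrable_compact_support)

lemma integrable_Cc:
  fixes f :: "'a::t2_space \<Rightarrow> complex"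
  shows "radon_measure \<mu> \<Longrightarrow> f \<in> Cc \<Longrightarrow> integrable \<mu> f"
  by (erule CcE) (rule integrable_compact_support)

lemma positive_real_functional_integral:
  fixes \<mu> :: "'a::t2_space measure"
  assumes "locally_compact_space (euclidean :: 'a topology)" "radon_measure \<mu>"
  shows "positive_real_functional (\<lambda>f. integral\<^sup>L \<mu> f)"
proof
  show "locally_compact_space (euclidean :: 'a topology)" by fact
qed (simp_all add: integrable_Cc_real[OF assms(2)])

lemma emeasure_le_integral:
  fixes g :: "'a::t2_space \<Rightarrow> real"
  assumes \<mu>: "radon_measure \<mu>" and g: "g \<in> Cc_real" "\<And>x. 0 \<le> g x"
    and K: "K \<in> sets borel" "\<And>x. x \<in> K \<Longrightarrow> 1 \<le> g x"
  shows "emeasure \<mu> K \<le> ennreal (integral\<^sup>L \<mu> g)"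
proof -
  have "emeasure \<mu> K = (\<integral>\<^sup>+x. indicator K x \<partial>\<mu>)"
    using K radon_sets[OF \<mu>] by simp
  also have "\<dots> \<le> (\<integral>\<^sup>+x. ennreal (g x) \<partial>\<mu>)"
    using K by (intro nn_integral_mono) (auto simp: indicator_def)
  also have "\<dots> = ennreal (integral\<^sup>L \<mu> g)"
    using g \<mu> by (intro nn_integral_eq_integral integrable_Cc_real) auto
  finally show ?thesis .
qed

lemma integral_le_emeasure:
  fixes f :: "'a::t2_space \<Rightarrow> real"
  assumes \<mu>: "radon_measure \<mu>" and f: "f \<in> Cc_real" "\<And>x. 0 \<le> f x" "\<And>x. f x \<le> 1"
    and A: "A \<in> sets borel" "\<And>x. x \<notin> A \<Longrightarrow> f x = 0"
  shows "ennreal (integral\<^sup>L \<mu> f) \<le> emeasure \<mu> A"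
proof -
  have "ennreal (integral\<^sup>L \<mu> f) = (\<integral>\<^sup>+x. ennreal (f x) \<partial>\<mu>)"
    using f \<mu> by (intro nn_integral_eq_integral[symmetric] integrable_Cc_real) auto
  also have "\<dots> \<le> (\<integral>\<^sup>+x. indicator A x \<partial>\<mu>)"
    using f A by (intro nn_integral_mono) (auto simp: indicator_def)
  also have "\<dots> = emeasure \<mu> A"
    using A radon_sets[OF \<mu>] by simp
  finally show ?thesis .
qed

context positive_real_functional
begin

text \<open>
  Both inequalities come from \<open>positive_real_functional_le\<close>, with the two functionals in either
  order: the indicator that fits between \<open>f\<close> and \<open>g\<close> is that of the support \<open>S\<close> of \<open>f\<close>, and the
  measure of \<open>S\<close> is at least the integral of \<open>f\<close> and at least \<open>I f\<close>, and at most the integral of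
  \<open>g\<close> and at most \<open>I g\<close>.
\<close>

lemma integral_riesz_measure_nonneg:
  assumes F: "F \<in> Cc_real" "\<And>x. 0 \<le> F x"
  shows "integral\<^sup>L riesz_measure F = I F"
proof (rule antisym)
  note radon = radon_measure_riesz_measure
  note J = positive_real_functional_integral[OF locally_compact radon]
  have borel: "closure {x. f x \<noteq> 0} \<in> sets borel" for f :: "'a \<Rightarrow> real"
    by (simp add: borel_closed)
  have one: "1 \<le> g x"
    if g: "g \<in> Cc_real" and fg: "\<And>x. f x \<noteq> 0 \<Longrightarrow> g x = 1" and x: "x \<in> closure {x. f x \<noteq> 0}"
    for f g :: "'a \<Rightarrow> real" and x
  proof -
    have "continuous_on UNIV g"
      using g by (simp add: Cc_real_def)
    then have "closed {x. 1 \<le> g x}"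
      by (intro closed_Collect_le continuous_on_const)
    then have "closure {x. f x \<noteq> 0} \<subseteq> {x. 1 \<le> g x}"
      using fg by (intro closure_minimal) auto
    then show "1 \<le> g x" using x by blast
  qed
  have out: "x \<notin> closure {x. f x \<noteq> 0} \<Longrightarrow> f x = 0" for f :: "'a \<Rightarrow> real" and x
    using closure_subset[of "{x. f x \<noteq> 0}"] by auto
  show "I F \<le> integral\<^sup>L riesz_measure F"
  proof (rule positive_real_functional_le[OF positive_real_functional_axioms J _ F])
    fix f g :: "'a \<Rightarrow> real" assume f: "f \<in> Cc_real" "\<And>x. 0 \<le> f x" "\<And>x. f x \<le> 1" 
      and g: "g \<in> Cc_real" "\<And>x. 0 \<le> g x" "\<And>x. f x \<noteq> 0 \<Longrightarrow> g x = 1"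
    have "ennreal (I f) \<le> outer (closure {x. f x \<noteq> 0})"
      using f by (intro le_outer_support) (auto simp: subordinate_def)
    also have "\<dots> \<le> ennreal (integral\<^sup>L riesz_measure g)"
      using emeasure_le_integral[OF radon g(1,2) borel one[OF g(1,3)]] borel
      by (simp add: emeasure_riesz_measure)
    finally show "I f \<le> integral\<^sup>L riesz_measure g"
      using g by (simp add: ennreal_le_iff)
  qed
  show "integral\<^sup>L riesz_measure F \<le> I F"
  proof (rule positive_real_functional_le[OF J positive_real_functional_axioms _ F])
    fix f g :: "'a \<Rightarrow> real" assume f: "f \<in> Cc_real" "\<And>x. 0 \<le> f x" "\<And>x. f x \<le> 1" 
      and g: "g \<in> Cc_real" "\<And>x. 0 \<le> g x" "\<And>x. f x \<noteq> 0 \<Longrightarrow> g x = 1"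
    have "ennreal (integral\<^sup>L riesz_measure f) \<le> outer (closure {x. f x \<noteq> 0})"
      using integral_le_emeasure[OF radon f borel out[of _ f]] borel
      by (simp add: emeasure_riesz_measure)
    also have "\<dots> \<le> ennreal (I g)"
      using g one[OF g(1,3)] by (intro outer_le_of_ge_one)
    finally show "integral\<^sup>L riesz_measure f \<le> I g"
      using g by (simp add: ennreal_le_iff nonneg)
  qed
qed

lemma integral_riesz_measure:
  assumes F: "F \<in> Cc_real"
  shows "integral\<^sup>L riesz_measure F = I F"
proof -
  note pos = Cc_real_positive_part[OF F] and neg = Cc_real_negative_part[OF F]
  have eq: "max 0 (F x) = F x + max 0 (- F x)" for x
    by (simp add: max_def)
  interpret J: positive_real_functional "\<lambda>f. integral\<^sup>L riesz_measure f"
    by (rule positive_real_functional_integral[OF locally_compact radon_measure_riesz_measure])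
  have "I (\<lambda>x. max 0 (F x)) = I F + I (\<lambda>x. max 0 (- F x))"
    unfolding eq by (rule add[OF F neg])
  moreover have "integral\<^sup>L riesz_measure (\<lambda>x. max 0 (F x)) =
      integral\<^sup>L riesz_measure F + integral\<^sup>L riesz_measure (\<lambda>x. max 0 (- F x))"
    unfolding eq by (rule J.add[OF F neg])
  ultimately show ?thesis
    using integral_riesz_measure_nonneg[OF pos] integral_riesz_measure_nonneg[OF neg] by simp
qed

end

section \<open>The Riesz representation theorem for complex functionals\<close>

lemma Cc_of_real: "f \<in> Cc_real \<Longrightarrow> (\<lambda>x. complex_of_real (f x)) \<in> Cc"
  by (auto simp: Cc_def Cc_real_def intro!: continuous_intros)

lemma Cc_real_compose_complex:
  fixes f :: "'a::t2_space \<Rightarrow> complex"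
  assumes "f \<in> Cc" "continuous_on UNIV h" "h 0 = 0"
  shows "(\<lambda>x. h (f x)) \<in> Cc_real"
proof -
  obtain K where K: "continuous_on UNIV f" "compact K" "\<And>x. x \<notin> K \<Longrightarrow> f x = 0"
    using assms(1) by (metis CcE)
  have "continuous_on UNIV (\<lambda>x. h (f x))"
    using K(1) assms(2) by (metis continuous_on_compose2 subset_UNIV)
  then show ?thesis
    using K assms(3) by (intro Cc_realI[of _ K]) auto
qed

lemma Cc_real_Re:
  fixes f :: "'a::t2_space \<Rightarrow> complex"
  shows "f \<in> Cc \<Longrightarrow> (\<lambda>x. Re (f x)) \<in> Cc_real"
  by (rule Cc_real_compose_complex[where h = Re]) (auto intro!: continuous_intros)

lemma Cc_real_Im:
  fixes f :: "'a::t2_space \<Rightarrow> complex"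
  shows "f \<in> Cc \<Longrightarrow> (\<lambda>x. Im (f x)) \<in> Cc_real"
  by (rule Cc_real_compose_complex[where h = Im]) (auto intro!: continuous_intros)

lemma Cc_add:
  fixes f g :: "'a::t2_space \<Rightarrow> complex"
  assumes "f \<in> Cc" "g \<in> Cc"
  shows "(\<lambda>x. f x + g x) \<in> Cc"
proof -
  obtain K where K: "continuous_on UNIV f" "compact K" "\<And>x. x \<notin> K \<Longrightarrow> f x = 0"
    using assms(1) by (metis CcE)
  obtain L where L: "continuous_on UNIV g" "compact L" "\<And>x. x \<notin> L \<Longrightarrow> g x = 0"
    using assms(2) by (metis CcE)
  show ?thesis
    using K L by (intro CcI[of _ "K \<union> L"] continuous_intros) auto
qed

lemma Cc_cmult:
  fixes f :: "'a::t2_space \<Rightarrow> complex"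
  assumes "f \<in> Cc"
  shows "(\<lambda>x. c * f x) \<in> Cc"
proof -
  obtain K where K: "continuous_on UNIV f" "compact K" "\<And>x. x \<notin> K \<Longrightarrow> f x = 0"
    using assms by (metis CcE)
  then show ?thesis
    by (intro CcI[of _ K] continuous_intros) auto
qed

lemma Cc_compose_homeomorphism:
  fixes f :: "'a::t2_space \<Rightarrow> complex" and T :: "'b::t2_space \<Rightarrow> 'a"
  assumes "f \<in> Cc" and T: "homeomorphism UNIV UNIV T S"
  shows "(\<lambda>x. f (T x)) \<in> Cc"
proof -
  obtain K where K: "continuous_on UNIV f" "compact K" "\<And>x. x \<notin> K \<Longrightarrow> f x = 0"
    using assms by (metis CcE)
  show ?thesis
  proof (rule CcI)
    show "continuous_on UNIV (\<lambda>x. f (T x))"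
      using K(1) T by (metis continuous_on_compose2 homeomorphism_def subset_UNIV)
    show "compact (S ` K)"
      using K(2) T by (metis compact_continuous_image continuous_on_subset homeomorphism_def subset_UNIV)
    fix x assume x: "x \<notin> S ` K"
    have "x = S (T x)" using T by (simp add: homeomorphism_def)
    then show "f (T x) = 0" using x K(3) by blast
  qed
qed

locale positive_complex_functional =
  fixes L :: "('a::t2_space \<Rightarrow> complex) \<Rightarrow> complex"
  assumes locally_compact: "locally_compact_space (euclidean :: 'a topology)"
    and linear: "linear_functional L"
    and positive: "positive_functional L"
begin

definition real_part :: "('a \<Rightarrow> real) \<Rightarrow> real" where
  "real_part f = Re (L (\<lambda>x. complex_of_real (f x)))"

lemma add: "f \<in> Cc \<Longrightarrow> h \<in> Cc \<Longrightarrow> L (\<lambda>x. f x + h x) = L f + L h"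
  using linear by (simp add: linear_functional_def)

lemma cmult: "f \<in> Cc \<Longrightarrow> L (\<lambda>x. c * f x) = c * L f"
  using linear by (simp add: linear_functional_def)

lemma nonneg:
  assumes "f \<in> Cc_real" "\<And>x. 0 \<le> f x"
  shows "L (\<lambda>x. complex_of_real (f x)) \<in> \<real>\<^sub>\<ge>\<^sub>0"
  using positive Cc_of_real[OF assms(1)] assms(2) by (auto simp: positive_functional_def)

sublocale real_part: positive_real_functional real_part
proof
  show "locally_compact_space (euclidean :: 'a topology)" by (rule locally_compact)
  show "real_part (\<lambda>x. f x + g x) = real_part f + real_part g" if "f \<in> Cc_real" "g \<in> Cc_real" for f g
    using add[OF Cc_of_real[OF that(1)] Cc_of_real[OF that(2)]] by (simp add: real_part_def)
  show "real_part (\<lambda>x. c * f x) = c * real_part f" if "f \<in> Cc_real" for f c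
    using cmult[OF Cc_of_real[OF that], of "complex_of_real c"] by (simp add: real_part_def)
  show "0 \<le> real_part f" if "f \<in> Cc_real" "\<And>x. 0 \<le> f x" for f
    using nonneg[OF that] by (auto simp: real_part_def complex_nonneg_Reals_iff)
qed

text \<open>
  Positivity makes \<open>L\<close> real on non-negative functions, hence on differences of such functions. So
  \<open>L\<close> is determined by the real functional \<open>real_part\<close>, to which the construction above applies.
\<close>

lemma of_real_eq:
  assumes F: "F \<in> Cc_real"
  shows "L (\<lambda>x. complex_of_real (F x)) = complex_of_real (real_part F)"
proof -
  note pos = Cc_real_positive_part[OF F] and neg = Cc_real_negative_part[OF F]
  have eq: "complex_of_real (max 0 (F x)) = complex_of_real (F x) + complex_of_real (max 0 (- F x))" for x
    by (simp add: max_def)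
  have "L (\<lambda>x. complex_of_real (max 0 (F x))) =
      L (\<lambda>x. complex_of_real (F x)) + L (\<lambda>x. complex_of_real (max 0 (- F x)))"
    unfolding eq by (rule add[OF Cc_of_real[OF F] Cc_of_real[OF neg]])
  moreover have "Im (L (\<lambda>x. complex_of_real (max 0 (F x)))) = 0"
    using nonneg[OF pos] by (simp add: complex_nonneg_Reals_iff)
  moreover have "Im (L (\<lambda>x. complex_of_real (max 0 (- F x)))) = 0"
    using nonneg[OF neg] by (simp add: complex_nonneg_Reals_iff)
  ultimately show ?thesis
    by (simp add: complex_eq_iff real_part_def)
qed

lemma represents_riesz_measure: "represents real_part.riesz_measure L"
  unfolding represents_def
proof (intro conjI ballI)
  let ?\<mu> = real_part.riesz_measure
  show radon: "radon_measure ?\<mu>"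
    by (rule real_part.radon_measure_riesz_measure)
  fix f :: "'a \<Rightarrow> complex" assume f: "f \<in> Cc"
  note re = Cc_real_Re[OF f] and im = Cc_real_Im[OF f]
  have "L f = L (\<lambda>x. complex_of_real (Re (f x)) + \<i> * complex_of_real (Im (f x)))"
    by (simp flip: complex_eq)
  also have "\<dots> = complex_of_real (real_part (\<lambda>x. Re (f x))) + \<i> * complex_of_real (real_part (\<lambda>x. Im (f x)))"
    using add[OF Cc_of_real[OF re] Cc_cmult[OF Cc_of_real[OF im]], of \<i>]
      cmult[OF Cc_of_real[OF im], of \<i>] of_real_eq[OF re] of_real_eq[OF im] by simp
  also have "\<dots> = integral\<^sup>L ?\<mu> f"
    using integrable_Cc[OF radon f]
    by (simp add: complex_eq_iff real_part.integral_riesz_measure[OF re, symmetric]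
        real_part.integral_riesz_measure[OF im, symmetric])
  finally show "L f = integral\<^sup>L ?\<mu> f" .
qed

end

text \<open>
  A Urysohn function fits between the indicators of a compact \<open>K\<close> and of an open set \<open>U\<close> around
  it, so integrals control the measure of compact subsets of \<open>U\<close>, and by inner regularity that of
  \<open>U\<close>. Outer regularity extends the resulting equality to all Borel sets in \<open>represents_unique\<close>.
\<close>

lemma emeasure_open_le_of_integral_eq:
  fixes \<mu> \<nu> :: "'a::t2_space measure"
  assumes lc: "locally_compact_space (euclidean :: 'a topology)"
    and \<mu>: "radon_measure \<mu>" and \<nu>: "radon_measure \<nu>"
    and eq: "\<And>f. f \<in> Cc_real \<Longrightarrow> integral\<^sup>L \<mu> f = integral\<^sup>L \<nu> f"
    and U: "open U"
  shows "emeasure \<mu> U \<le> emeasure \<nu> U"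
proof -
  have "emeasure \<mu> K \<le> emeasure \<nu> U" if K: "compact K" "K \<subseteq> U" for K
  proof -
    obtain g W where g: "g \<in> Cc_real" "\<And>x. 0 \<le> g x" "\<And>x. g x \<le> 1" "closure {x. g x \<noteq> 0} \<subseteq> U"
      and W: "K \<subseteq> W" "\<And>x. x \<in> W \<Longrightarrow> g x = 1"
      using Urysohn_compact_support[OF lc K(1) U K(2)] by metis
    have "emeasure \<mu> K \<le> ennreal (integral\<^sup>L \<mu> g)"
      using \<mu> g(1,2) K W by (intro emeasure_le_integral) (auto simp: borel_closed compact_imp_closed)
    also have "\<dots> \<le> emeasure \<nu> U"
      unfolding eq[OF g(1)] using \<nu> g U closure_subset[of "{x. g x \<noteq> 0}"]
      by (intro integral_le_emeasure) auto
    finally show ?thesis .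
  qed
  then have "(SUP K\<in>{K. compact K \<and> K \<subseteq> U}. emeasure \<mu> K) \<le> emeasure \<nu> U"
    by (auto intro: SUP_least)
  then show ?thesis
    using radon_inner_regular[OF \<mu> U] by simp
qed

lemma represents_unique:
  fixes \<mu> \<nu> :: "'a::t2_space measure"
  assumes lc: "locally_compact_space (euclidean :: 'a topology)"
    and \<mu>: "represents \<mu> L" and \<nu>: "represents \<nu> L"
  shows "\<mu> = \<nu>"
proof -
  have radon: "radon_measure \<mu>" "radon_measure \<nu>"
    using \<mu> \<nu> by (auto simp: represents_def)
  have eq: "integral\<^sup>L \<mu> f = integral\<^sup>L \<nu> f" if "f \<in> Cc_real" for f
  proof -
    have "integral\<^sup>L \<mu> (\<lambda>x. complex_of_real (f x)) = integral\<^sup>L \<nu> (\<lambda>x. complex_of_real (f x))"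
      using \<mu> \<nu> Cc_of_real[OF that] unfolding represents_def by metis
    then show ?thesis by simp
  qed
  have opens: "emeasure \<mu> U = emeasure \<nu> U" if "open U" for U
    by (intro antisym emeasure_open_le_of_integral_eq[OF lc] radon eq eq[symmetric] that)
  show ?thesis
  proof (rule measure_eqI)
    show "sets \<mu> = sets \<nu>"
      using radon by (simp add: radon_sets)
    fix E assume "E \<in> sets \<mu>"
    then have E: "E \<in> sets borel"
      using radon by (simp add: radon_sets)
    show "emeasure \<mu> E = emeasure \<nu> E"
      unfolding radon_outer_regular[OF radon(1) E] radon_outer_regular[OF radon(2) E]
      by (intro INF_cong) (auto simp: opens)
  qed
qed

section \<open>Measures and functionals invariant under a transitive family of homeomorphisms\<close>

lemma emeasure_distr_homeomorphism:
  fixes \<mu> :: "'a::t2_space measure" and T :: "'a \<Rightarrow> 'b::t2_space"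
  assumes \<mu>: "sets \<mu> = sets borel" and T: "homeomorphism UNIV UNIV T S" and E: "E \<in> sets borel"
  shows "emeasure (distr \<mu> borel T) E = emeasure \<mu> (S ` E)"
proof -
  have "T \<in> borel_measurable borel"
    using T by (auto simp: homeomorphism_def intro: borel_measurable_continuous_onI)
  then have meas: "T \<in> measurable \<mu> borel"
    using measurable_cong_sets[OF \<mu> refl] by blast
  have "space \<mu> = UNIV"
    using sets_eq_imp_space_eq[OF \<mu>] by simp
  moreover have "T -` E = S ` E"
    using T unfolding homeomorphism_def by (auto simp: image_iff) metis
  ultimately show ?thesis
    using emeasure_distr[OF meas E] by simp
qed

lemma radon_measure_distr_homeomorphism:
  fixes \<mu> :: "'a::t2_space measure" and T :: "'a \<Rightarrow> 'b::t2_space"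
  assumes \<mu>: "radon_measure \<mu>" and T: "homeomorphism UNIV UNIV T S"
  shows "radon_measure (distr \<mu> borel T)"
proof -
  note distr = emeasure_distr_homeomorphism[OF radon_sets[OF \<mu>] T]
  have ST: "S (T x) = x" "T (S y) = y" and cont: "continuous_on UNIV T" "continuous_on UNIV S" for x y
    using T by (auto simp: homeomorphism_def)
  have "inj S"
    using ST(2) by (rule inj_on_inverseI)
  have img: "S ` A = T -` A" for A
    using ST by (auto simp: image_iff) metis
  have "S -` S ` A = A" for A
    using \<open>inj S\<close> by (rule inj_vimage_image_eq)
  then have opn: "open (S ` A) \<longleftrightarrow> open A" for A
    using cont img open_vimage by metis
  have "T ` S ` A = A" for A
    by (simp add: image_image ST)
  then have cpt: "compact (S ` A) \<longleftrightarrow> compact A" for A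
    using cont by (metis compact_continuous_image continuous_on_subset subset_UNIV)
  have sub: "S ` A \<subseteq> S ` B \<longleftrightarrow> A \<subseteq> B" for A B
    using \<open>inj S\<close> by (rule inj_image_subset_iff)
  have S_image: "\<exists>B. A = S ` B" for A
    by (rule exI[of _ "T ` A"]) (simp add: image_image ST)
  have bor: "S ` A \<in> sets borel" if "A \<in> sets borel" for A
    unfolding img using measurable_sets[OF borel_measurable_continuous_onI[OF cont(1)] that] by simp
  have INF_eq: "(INF U\<in>{U. open U \<and> E \<subseteq> U}. emeasure \<mu> (S ` U)) = (INF U\<in>{U. open U \<and> S ` E \<subseteq> U}. emeasure \<mu> U)" for E
  proof -
    have "{U. open U \<and> S ` E \<subseteq> U} = (`) S ` {U. open U \<and> E \<subseteq> U}"
    proof (intro antisym subsetI)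
      fix V assume V: "V \<in> {U. open U \<and> S ` E \<subseteq> U}"
      obtain U where U: "V = S ` U" using S_image by blast
      then show "V \<in> (`) S ` {U. open U \<and> E \<subseteq> U}"
        using V opn sub by auto
    qed (use opn in auto)
    then show ?thesis by (simp add: image_image)
  qed
  have SUP_eq: "(SUP K\<in>{K. compact K \<and> K \<subseteq> U}. emeasure \<mu> (S ` K)) = (SUP K\<in>{K. compact K \<and> K \<subseteq> S ` U}. emeasure \<mu> K)" for U
  proof -
    have "{K. compact K \<and> K \<subseteq> S ` U} = (`) S ` {K. compact K \<and> K \<subseteq> U}"
    proof (intro antisym subsetI)
      fix C assume C: "C \<in> {K. compact K \<and> K \<subseteq> S ` U}"
      obtain K where K: "C = S ` K" using S_image by blast
      then show "C \<in> (`) S ` {K. compact K \<and> K \<subseteq> U}"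
        using C cpt sub by auto
    qed (use cpt in auto)
    then show ?thesis by (simp add: image_image)
  qed
  show ?thesis
    unfolding radon_measure_def
  proof (intro conjI allI impI ballI)
    show "emeasure (distr \<mu> borel T) K < \<infinity>" if "compact K" for K
      using that distr[of K] emeasure_compact_finite[OF \<mu>, of "S ` K"] cpt
      by (simp add: borel_closed compact_imp_closed)
    show "emeasure (distr \<mu> borel T) E = (INF U\<in>{U. open U \<and> E \<subseteq> U}. emeasure (distr \<mu> borel T) U)"
      if E: "E \<in> sets borel" for E
    proof -
      have "(INF U\<in>{U. open U \<and> E \<subseteq> U}. emeasure (distr \<mu> borel T) U) =
          (INF U\<in>{U. open U \<and> E \<subseteq> U}. emeasure \<mu> (S ` U))"
        by (intro INF_cong) (auto simp: distr)
      then show ?thesis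
        unfolding distr[OF E] radon_outer_regular[OF \<mu> bor[OF E]] INF_eq by simp
    qed
    show "emeasure (distr \<mu> borel T) U = (SUP K\<in>{K. compact K \<and> K \<subseteq> U}. emeasure (distr \<mu> borel T) K)"
      if U: "open U" for U
    proof -
      have "(SUP K\<in>{K. compact K \<and> K \<subseteq> U}. emeasure (distr \<mu> borel T) K) =
          (SUP K\<in>{K. compact K \<and> K \<subseteq> U}. emeasure \<mu> (S ` K))"
        by (intro SUP_cong) (auto simp: distr borel_closed compact_imp_closed)
      then show ?thesis
        using radon_inner_regular[OF \<mu>, of "S ` U"] U by (simp add: distr SUP_eq opn)
    qed
  qed simp
qed

definition invariant_measures :: "('g \<Rightarrow> 'a \<Rightarrow> 'a) \<Rightarrow> 'a::t2_space measure set" where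
  "invariant_measures \<tau> =
     {\<mu>. radon_measure \<mu> \<and>
         (\<forall>U. open U \<and> U \<noteq> {} \<longrightarrow> emeasure \<mu> U > 0) \<and>
         (\<forall>E\<in>sets borel. \<forall>g. emeasure \<mu> (\<tau> g ` E) = emeasure \<mu> E)}"

definition invariant_functionals ::
    "('g \<Rightarrow> 'a \<Rightarrow> 'a) \<Rightarrow> (('a::t2_space \<Rightarrow> complex) \<Rightarrow> complex) set" where
  "invariant_functionals \<tau> =
     {L. linear_functional L \<and> positive_functional L \<and> (\<exists>f\<in>Cc. L f \<noteq> 0) \<and>
         (\<forall>g. \<forall>f\<in>Cc. L (\<lambda>x. f (\<tau> g x)) = L f)}"

text \<open>
  Left and right translations share only three properties that matter here: they are
  homeomorphisms, their inverses are again such translations, and they act transitively. The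
  correspondence is therefore proved for any family \<open>\<tau>\<close> with these properties, and both halves of
  the theorem are instances of it.
\<close>

locale transitive_homeomorphisms =
  fixes \<tau> :: "'g \<Rightarrow> 'a::t2_space \<Rightarrow> 'a"
  assumes locally_compact: "locally_compact_space (euclidean :: 'a topology)"
    and inverse: "\<exists>h. homeomorphism UNIV UNIV (\<tau> g) (\<tau> h)"
    and transitive: "\<exists>g. \<tau> g x = y"
begin

lemma represents_\<Phi>: "radon_measure \<mu> \<Longrightarrow> represents \<mu> (\<Phi> \<mu>)"
  by (simp add: represents_def \<Phi>_def)

lemma \<Psi>_eqI:
  fixes L :: "('a \<Rightarrow> complex) \<Rightarrow> complex"
  shows "represents \<mu> L \<Longrightarrow> \<Psi> L = \<mu>"
  unfolding \<Psi>_def using represents_unique[OF locally_compact] by blast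

text \<open>
  Invariance of the measure says that its image under \<open>\<tau> g\<close> is the measure itself, and then the
  change of variables formula is the invariance of the integral. The functional is non-zero since
  some non-negative function of compact support is $1$ on a non-empty open set.
\<close>

lemma \<Phi>_invariant:
  assumes "\<mu> \<in> invariant_measures \<tau>"
  shows "\<Phi> \<mu> \<in> invariant_functionals \<tau>"
proof -
  have \<mu>: "radon_measure \<mu>" and pos: "\<And>U. open U \<Longrightarrow> U \<noteq> {} \<Longrightarrow> emeasure \<mu> U > 0"
    and inv: "\<And>E g. E \<in> sets borel \<Longrightarrow> emeasure \<mu> (\<tau> g ` E) = emeasure \<mu> E"
    using assms by (auto simp: invariant_measures_def)
  have val: "\<Phi> \<mu> f = integral\<^sup>L \<mu> f" if "f \<in> Cc" for f
    using that by (simp add: \<Phi>_def)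
  have "linear_functional (\<Phi> \<mu>)"
    unfolding linear_functional_def
  proof (intro conjI ballI allI)
    show "\<Phi> \<mu> \<in> extensional Cc"
      by (simp add: \<Phi>_def)
    show "\<Phi> \<mu> (\<lambda>x. f x + h x) = \<Phi> \<mu> f + \<Phi> \<mu> h" if "f \<in> Cc" "h \<in> Cc" for f h
      using that by (simp add: val Cc_add integrable_Cc[OF \<mu>])
    show "\<Phi> \<mu> (\<lambda>x. c * f x) = c * \<Phi> \<mu> f" if "f \<in> Cc" for c f
      using that by (simp add: val Cc_cmult integrable_Cc[OF \<mu>])
  qed
  moreover have "positive_functional (\<Phi> \<mu>)"
    unfolding positive_functional_def
  proof (intro ballI impI)
    fix f :: "'a \<Rightarrow> complex" assume f: "f \<in> Cc" "\<forall>x. f x \<in> \<real>\<^sub>\<ge>\<^sub>0"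
    then have "Re (integral\<^sup>L \<mu> f) \<ge> 0" "Im (integral\<^sup>L \<mu> f) = 0"
      using integrable_Cc[OF \<mu> f(1)]
      by (simp_all add: complex_nonneg_Reals_iff flip: integral_Re integral_Im)
    then show "\<Phi> \<mu> f \<in> \<real>\<^sub>\<ge>\<^sub>0"
      using f by (simp add: val complex_nonneg_Reals_iff)
  qed
  moreover have "\<exists>f\<in>Cc. \<Phi> \<mu> f \<noteq> 0"
  proof -
    have cpt: "compact {undefined :: 'a}" by simp
    obtain h :: "'a \<Rightarrow> real" and W where h: "h \<in> Cc_real" "\<And>x. 0 \<le> h x"
      and W: "open W" "{undefined} \<subseteq> W" "\<And>x. x \<in> W \<Longrightarrow> h x = 1"
      using Urysohn_compact_support[OF locally_compact cpt open_UNIV subset_UNIV] by metis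
    have "0 < emeasure \<mu> W"
      using W by (intro pos) auto
    also have "\<dots> \<le> ennreal (integral\<^sup>L \<mu> h)"
      using \<mu> h W by (intro emeasure_le_integral) auto
    finally have "\<Phi> \<mu> (\<lambda>x. complex_of_real (h x)) \<noteq> 0"
      using Cc_of_real[OF h(1)] by (simp add: val)
    then show ?thesis
      using Cc_of_real[OF h(1)] by blast
  qed
  moreover have "\<Phi> \<mu> (\<lambda>x. f (\<tau> g x)) = \<Phi> \<mu> f" if f: "f \<in> Cc" for f g
  proof -
    obtain h where h: "homeomorphism UNIV UNIV (\<tau> g) (\<tau> h)"
      using inverse by blast
    have "distr \<mu> borel (\<tau> g) = \<mu>"
      using emeasure_distr_homeomorphism[OF radon_sets[OF \<mu>] h] inv
      by (intro measure_eqI) (auto simp: radon_sets[OF \<mu>])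
    moreover have "\<tau> g \<in> borel_measurable \<mu>" "f \<in> borel_measurable borel"
      using h f measurable_cong_sets[OF radon_sets[OF \<mu>] refl]
      by (auto simp: homeomorphism_def Cc_def intro!: borel_measurable_continuous_onI)
    ultimately have "integral\<^sup>L \<mu> (\<lambda>x. f (\<tau> g x)) = integral\<^sup>L \<mu> f"
      using integral_distr[of "\<tau> g" \<mu> borel f] by simp
    then show ?thesis
      using f Cc_compose_homeomorphism[OF f h] by (simp add: val)
  qed
  ultimately show ?thesis
    by (simp add: invariant_functionals_def)
qed

lemma ex1_represents:
  assumes "L \<in> invariant_functionals \<tau>"
  shows "\<exists>!\<mu>. represents \<mu> L"
proof -
  interpret positive_complex_functional L
    using assms locally_compact by unfold_locales (auto simp: invariant_functionals_def)
  show ?thesis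
    using represents_riesz_measure represents_unique[OF locally_compact] by blast
qed

text \<open>
  The image of \<open>\<mu>\<close> under a homeomorphism of the family is a Radon measure representing the same
  functional, so it equals \<open>\<mu>\<close> by uniqueness. If a non-empty open set were null, then its
  translates would be null; by transitivity they cover the space, finitely many of them cover the
  support of a given function, and so all integrals would vanish.
\<close>

lemma represents_invariant:
  assumes L: "L \<in> invariant_functionals \<tau>" and rep: "represents \<mu> L"
  shows "\<mu> \<in> invariant_measures \<tau>"
proof -
  have \<mu>: "radon_measure \<mu>" and int: "\<And>f. f \<in> Cc \<Longrightarrow> L f = integral\<^sup>L \<mu> f"
    using rep by (auto simp: represents_def)
  have invL: "\<And>f g. f \<in> Cc \<Longrightarrow> L (\<lambda>x. f (\<tau> g x)) = L f"
    using L by (auto simp: invariant_functionals_def)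
  obtain f0 where f0: "f0 \<in> Cc" "L f0 \<noteq> 0"
    using L by (auto simp: invariant_functionals_def)
  have inv: "emeasure \<mu> (\<tau> g ` E) = emeasure \<mu> E" if E: "E \<in> sets borel" for E g
  proof -
    obtain h where "homeomorphism UNIV UNIV (\<tau> g) (\<tau> h)"
      using inverse by blast
    then have h: "homeomorphism UNIV UNIV (\<tau> h) (\<tau> g)"
      by (rule homeomorphism_symD)
    have "represents (distr \<mu> borel (\<tau> h)) L"
      unfolding represents_def
    proof (intro conjI ballI)
      show "radon_measure (distr \<mu> borel (\<tau> h))"
        using \<mu> h by (rule radon_measure_distr_homeomorphism)
      fix f :: "'a \<Rightarrow> complex" assume f: "f \<in> Cc"
      have "\<tau> h \<in> borel_measurable \<mu>" "f \<in> borel_measurable borel"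
        using h f measurable_cong_sets[OF radon_sets[OF \<mu>] refl]
        by (auto simp: homeomorphism_def Cc_def intro!: borel_measurable_continuous_onI)
      then have "integral\<^sup>L (distr \<mu> borel (\<tau> h)) f = integral\<^sup>L \<mu> (\<lambda>x. f (\<tau> h x))"
        by (rule integral_distr)
      also have "\<dots> = L f"
        using int[OF Cc_compose_homeomorphism[OF f h]] invL[OF f] by simp
      finally show "L f = integral\<^sup>L (distr \<mu> borel (\<tau> h)) f" by simp
    qed
    then have "distr \<mu> borel (\<tau> h) = \<mu>"
      using rep represents_unique[OF locally_compact] by blast
    then show ?thesis
      using emeasure_distr_homeomorphism[OF radon_sets[OF \<mu>] h E] by simp
  qed
  have "emeasure \<mu> U > 0" if U: "open U" "U \<noteq> {}" for U
  proof (rule ccontr)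
    assume "\<not> emeasure \<mu> U > 0"
    then have U0: "emeasure \<mu> U = 0" by simp
    obtain u where u: "u \<in> U" using U by blast
    \<comment> \<open>The translation indexed by g x moves the point u of U to x, so the translates of U cover the space.\<close>
    obtain g where g: "\<And>x. \<tau> (g x) u = x"
      using transitive[of u] by metis
    have opn: "open (\<tau> (g x) ` U)" for x
    proof -
      obtain h where "homeomorphism UNIV UNIV (\<tau> (g x)) (\<tau> h)"
        using inverse by blast
      then have "\<tau> (g x) ` U = \<tau> h -` U" "continuous_on UNIV (\<tau> h)"
        unfolding homeomorphism_def by (auto simp: image_iff) metis
      then show ?thesis
        using U by (simp add: open_vimage)
    qed
    obtain K where K: "continuous_on UNIV f0" "compact K" "\<And>x. x \<notin> K \<Longrightarrow> f0 x = 0"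
      using f0(1) by (metis CcE)
    have "x \<in> \<tau> (g x) ` U" for x
      using imageI[OF u, of "\<tau> (g x)"] by (simp add: g)
    then have "K \<subseteq> (\<Union>x\<in>K. \<tau> (g x) ` U)" by blast
    then obtain D where D: "finite D" "K \<subseteq> (\<Union>x\<in>D. \<tau> (g x) ` U)"
      by (rule compactE_image[OF K(2) opn])
    have "\<tau> (g x) ` U \<in> null_sets \<mu>" for x
      using inv[OF borel_open[OF U(1)], of "g x"] opn[of x] U0 radon_sets[OF \<mu>]
      by (simp add: null_sets_def)
    then have "(\<Union>x\<in>D. \<tau> (g x) ` U) \<in> null_sets \<mu>"
      using D by (intro null_sets_UN') (auto simp: countable_finite)
    moreover have "{x \<in> space \<mu>. \<not> f0 x = 0} \<subseteq> (\<Union>x\<in>D. \<tau> (g x) ` U)"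
      using D K by blast
    ultimately have "AE x in \<mu>. f0 x = 0"
      by (rule AE_I')
    then have "integral\<^sup>L \<mu> f0 = 0"
      by (rule integral_eq_zero_AE)
    then show False
      using f0 int by simp
  qed
  then show ?thesis
    using \<mu> inv by (simp add: invariant_measures_def)
qed

theorem invariant_measures_functionals_bijection:
  "(\<forall>\<mu>\<in>invariant_measures \<tau>. \<forall>f\<in>Cc. integrable \<mu> f) \<and>
   (\<forall>L\<in>invariant_functionals \<tau>. \<exists>!\<mu>. represents \<mu> L) \<and>
   \<Phi> \<in> invariant_measures \<tau> \<rightarrow> invariant_functionals \<tau> \<and>
   \<Psi> \<in> invariant_functionals \<tau> \<rightarrow> invariant_measures \<tau> \<and>
   (\<forall>\<mu>\<in>invariant_measures \<tau>. \<Psi> (\<Phi> \<mu>) = \<mu>) \<and>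
   (\<forall>L\<in>invariant_functionals \<tau>. \<Phi> (\<Psi> L) = L)"
proof (intro conjI ballI funcsetI)
  have radon: "radon_measure \<mu>" if "\<mu> \<in> invariant_measures \<tau>" for \<mu>
    using that by (simp add: invariant_measures_def)
  have rep: "represents (\<Psi> L) L" if "L \<in> invariant_functionals \<tau>" for L
    using ex1_represents[OF that] \<Psi>_eqI by blast
  show "integrable \<mu> f" if "\<mu> \<in> invariant_measures \<tau>" "f \<in> Cc" for \<mu> and f :: "'a \<Rightarrow> complex"
    using that by (intro integrable_Cc radon)
  show "\<Psi> L \<in> invariant_measures \<tau>" if "L \<in> invariant_functionals \<tau>" for L
    using that rep by (intro represents_invariant)
  show "\<Psi> (\<Phi> \<mu>) = \<mu>" if "\<mu> \<in> invariant_measures \<tau>" for \<mu>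
    using that by (intro \<Psi>_eqI represents_\<Phi> radon)
  show "\<Phi> (\<Psi> L) = L" if L: "L \<in> invariant_functionals \<tau>" for L
  proof (rule extensionalityI[of _ Cc])
    show "\<Phi> (\<Psi> L) \<in> extensional Cc" by (simp add: \<Phi>_def)
    show "L \<in> extensional Cc"
      using L by (simp add: invariant_functionals_def linear_functional_def)
    show "\<Phi> (\<Psi> L) f = L f" if "f \<in> Cc" for f
      using rep[OF L] that by (simp add: represents_def \<Phi>_def)
  qed
qed (fact \<Phi>_invariant ex1_represents)+

end

section \<open>Haar measures and Haar functionals\<close>

lemma homeomorphism_left_translation:
  fixes g :: "'a::topological_group_add"
  shows "homeomorphism UNIV UNIV (\<lambda>x. g + x) (\<lambda>x. - g + x)"
  by (intro homeomorphismI continuous_intros) (auto simp flip: add.assoc)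

lemma homeomorphism_right_translation:
  fixes g :: "'a::topological_group_add"
  shows "homeomorphism UNIV UNIV (\<lambda>x. x + g) (\<lambda>x. x + - g)"
  by (intro homeomorphismI continuous_intros) (auto simp: add.assoc)

lemma left_haar_measures_eq: "left_haar_measures = invariant_measures (+)"
  by (simp add: left_haar_measures_def invariant_measures_def)

text \<open>
  The left regular representation translates by \<open>- g\<close>; since \<open>g\<close> ranges over the whole group,
  translating by \<open>g\<close> gives the same condition.
\<close>

lemma left_haar_functionals_eq: "left_haar_functionals = invariant_functionals (+)"
proof -
  have "(\<forall>g. \<forall>f\<in>Cc. L (\<lambda>x. f (- g + x)) = L f) \<longleftrightarrow> (\<forall>g. \<forall>f\<in>Cc. L (\<lambda>x. f (g + x)) = L f)"
    for L :: "('a::{topological_group_add, t2_space} \<Rightarrow> complex) \<Rightarrow> complex"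
    by (metis minus_minus)
  then show ?thesis
    by (simp add: left_haar_functionals_def invariant_functionals_def left_regular_def)
qed

lemma right_haar_measures_eq: "right_haar_measures = invariant_measures (\<lambda>g x. x + g)"
  by (simp add: right_haar_measures_def invariant_measures_def)

lemma right_haar_functionals_eq: "right_haar_functionals = invariant_functionals (\<lambda>g x. x + g)"
  by (simp add: right_haar_functionals_def invariant_functionals_def right_regular_def)

theorem proposition2p6:
  assumes "locally_compact_space (euclidean :: 'a::{topological_group_add, t2_space} topology)"
  shows
    "((\<forall>\<mu>\<in>(left_haar_measures :: 'a measure set). \<forall>f\<in>Cc. integrable \<mu> f) \<and>
      (\<forall>L\<in>(left_haar_functionals :: (('a \<Rightarrow> complex) \<Rightarrow> complex) set). \<exists>!\<mu>. represents \<mu> L) \<and>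
      \<Phi> \<in> (left_haar_measures :: 'a measure set) \<rightarrow> left_haar_functionals \<and>
      \<Psi> \<in> left_haar_functionals \<rightarrow> (left_haar_measures :: 'a measure set) \<and>
      (\<forall>\<mu>\<in>(left_haar_measures :: 'a measure set). \<Psi> (\<Phi> \<mu>) = \<mu>) \<and>
      (\<forall>L\<in>(left_haar_functionals :: (('a \<Rightarrow> complex) \<Rightarrow> complex) set). \<Phi> (\<Psi> L) = L))
   \<and> ((\<forall>\<mu>\<in>(right_haar_measures :: 'a measure set). \<forall>f\<in>Cc. integrable \<mu> f) \<and>
      (\<forall>L\<in>(right_haar_functionals :: (('a \<Rightarrow> complex) \<Rightarrow> complex) set). \<exists>!\<mu>. represents \<mu> L) \<and>
      \<Phi> \<in> (right_haar_measures :: 'a measure set) \<rightarrow> right_haar_functionals \<and>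
      \<Psi> \<in> right_haar_functionals \<rightarrow> (right_haar_measures :: 'a measure set) \<and>
      (\<forall>\<mu>\<in>(right_haar_measures :: 'a measure set). \<Psi> (\<Phi> \<mu>) = \<mu>) \<and>
      (\<forall>L\<in>(right_haar_functionals :: (('a \<Rightarrow> complex) \<Rightarrow> complex) set). \<Phi> (\<Psi> L) = L))"
proof -
  interpret left: transitive_homeomorphisms "(+) :: 'a \<Rightarrow> 'a \<Rightarrow> 'a"
  proof
    show "\<exists>h. homeomorphism UNIV UNIV ((+) g) ((+) h)" for g :: 'a
      using homeomorphism_left_translation by blast
    show "\<exists>g. g + x = y" for x y :: 'a
      by (rule exI[of _ "y - x"]) simp
  qed (rule assms)
  interpret right: transitive_homeomorphisms "\<lambda>g x :: 'a. x + g"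
  proof
    show "\<exists>h. homeomorphism UNIV UNIV (\<lambda>x. x + g) (\<lambda>x. x + h)" for g :: 'a
      using homeomorphism_right_translation by blast
    show "\<exists>g. x + g = y" for x y :: 'a
      by (rule exI[of _ "- x + y"]) (simp flip: add.assoc)
  qed (rule assms)
  show ?thesis
    unfolding left_haar_measures_eq left_haar_functionals_eq right_haar_measures_eq right_haar_functionals_eq
    by (intro conjI left.invariant_measures_functionals_bijection right.invariant_measures_functionals_bijection)
qed

end
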